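(* Let $n\ge1$ and let $\theta$ be an integer. Then $L(n,\theta)$, ordered by $\le_\theta$, is a lattice, where for $a,b\in L(n,\theta)$ the greatest lower bound is $\inf_\theta(a,b)=c$ with $c$ defined recursively by $$c_i=\min\Big(\sum_{j=1}^{i}a_j,\ \sum_{j=1}^{i}b_j\Big)-\sum_{j=1}^{i-1}c_j\qquad(1\le i\le n).$$
   Context: A composition of $n$ is a sequence $a=(a_1,\ldots,a_n)$ of nonnegative integers with $\sum a_i=n$ (not necessarily decreasing, zeros allowed). For an integer $\theta$, a transition $T(\theta)$ transforms a composition $a$ into the composition $(a_1,\ldots,a_i-1,a_{i+1}+1,\ldots,a_n)$ for some $1\le i\le n-1$ with $a_i-a_{i+1}\ge\theta$ (and $a_i\ge1$, so that the result is a composition). $L(n,\theta)$ is the set of all compositions obtained from $N=(n,0,\ldots,0)$ by iterating $T(\theta)$. For $a,b\in L(n,\theta)$, $a\ge_\theta b$ means that $b$ is obtained from $a$ by a (possibly empty) finite sequence of transitions $T(\theta)$. *)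

theory Defs
  imports "HOL-Algebra.Lattice"
begin

(* The sequence (a_1, ..., a_n) is the list a of length n with a_i = a ! (i - 1).
   Entries are integers, so that no subtraction below is truncated. *)
definition composition :: "nat \<Rightarrow> int list \<Rightarrow> bool" where
  "composition n a \<longleftrightarrow> length a = n \<and> (\<forall>x\<in>set a. 0 \<le> x) \<and> sum_list a = int n"

definition transition :: "int \<Rightarrow> int list \<Rightarrow> int list \<Rightarrow> bool" where
  "transition \<theta> a b \<longleftrightarrow>
     (\<exists>i. Suc i < length a \<and> a ! i \<ge> 1 \<and> a ! i - a ! Suc i \<ge> \<theta> \<and>
          b = a[i := a ! i - 1, Suc i := a ! Suc i + 1])"

definition reaches :: "int \<Rightarrow> int list \<Rightarrow> int list \<Rightarrow> bool" where
  "reaches \<theta> = (transition \<theta>)\<^sup>*\<^sup>*"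

definition initial :: "nat \<Rightarrow> int list" where
  "initial n = int n # replicate (n - 1) 0"

definition L :: "nat \<Rightarrow> int \<Rightarrow> int list set" where
  "L n \<theta> = {a. composition n a \<and> reaches \<theta> (initial n) a}"

(* The larger element reaches the smaller one. *)
definition L_order :: "nat \<Rightarrow> int \<Rightarrow> int list gorder" where
  "L_order n \<theta> = \<lparr>carrier = L n \<theta>, eq = (=), le = (\<lambda>b a. reaches \<theta> a b)\<rparr>"

fun inf_entry :: "int list \<Rightarrow> int list \<Rightarrow> nat \<Rightarrow> int" where
  "inf_entry a b i =
     min (\<Sum>j\<le>i. a ! j) (\<Sum>j\<le>i. b ! j) - (\<Sum>j<i. inf_entry a b j)"

(* The defining equation is not a terminating rewrite rule. *)
declare inf_entry.simps [simp del]

definition inf_comp :: "nat \<Rightarrow> int list \<Rightarrow> int list \<Rightarrow> int list" where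
  "inf_comp n a b = map (inf_entry a b) [0..<n]"

end

theory Submission
  imports Defs
begin

text \<open>
  In terms of prefix sums, a transition at position \<open>i\<close> lowers only the \<open>i\<close>-th prefix sum, by one,
  and the prefix sums of \<open>inf_comp n a b\<close> are the pointwise minima of those of \<open>a\<close> and \<open>b\<close>.
  Taking the pointwise minimum with \<open>a\<close> along a path from the initial composition to \<open>b\<close> gives,
  after deleting repetitions, a path from \<open>a\<close> to \<open>inf_comp n a b\<close>. Hence \<open>L n \<theta>\<close> is closed
  under pointwise minima, and reachability between its elements is the pointwise order of the
  prefix sums.
\<close>

text \<open>The join is the meet of all upper bounds. That meet exists because the upper bounds form
  a finite set, nonempty since it contains \<open>t\<close>.\<close>

lemma (in weak_lower_semilattice) is_lub_exists_if_finite: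
  assumes "finite (carrier L)" and top: "t \<in> carrier L" "\<And>x. x \<in> carrier L \<Longrightarrow> x \<sqsubseteq> t"
    and "A \<subseteq> carrier L"
  shows "\<exists>s. is_lub L s A"
proof -
  have "t \<in> Upper L A"
    using top assms(4) by (auto simp: Upper_def)
  then have glb: "is_glb L (\<Sqinter>Upper L A) (Upper L A)"
    using assms(1) by (intro finite_inf_greatest) (auto intro: finite_subset)
  have "is_lub L (\<Sqinter>Upper L A) A"
  proof (rule least_UpperI)
    show "x \<sqsubseteq> \<Sqinter>Upper L A" if "x \<in> A" for x
      using that assms(4) by (intro greatest_le[OF glb] Lower_memI) auto
    show "\<Sqinter>Upper L A \<sqsubseteq> y" if "y \<in> Upper L A" for y
      using that by (intro greatest_Lower_below[OF glb]) auto
  qed (use assms(4) glb in auto)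
  then show ?thesis ..
qed

definition prefix_sum :: "int list \<Rightarrow> nat \<Rightarrow> int" where
  "prefix_sum a k = (\<Sum>j<k. a ! j)"

lemma prefix_sum_0 [simp]: "prefix_sum a 0 = 0"
  by (simp add: prefix_sum_def)

lemma nth_eq_diff_prefix_sum: "a ! i = prefix_sum a (Suc i) - prefix_sum a i"
  by (simp add: prefix_sum_def)

lemma list_eqI_prefix_sum:
  assumes "length a = length b"
    and "\<And>k. k \<le> length a \<Longrightarrow> prefix_sum a k = prefix_sum b k"
  shows "a = b"
  using assms by (intro nth_equalityI) (auto simp: nth_eq_diff_prefix_sum)

text \<open>Only the sum of the first \<open>Suc i\<close> entries separates the two changed
  positions; in longer sums the changes cancel.\<close>

lemma prefix_sum_fire:
  assumes "Suc i < length a"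
  shows "prefix_sum (a[i := a ! i - 1, Suc i := a ! Suc i + 1]) k =
    prefix_sum a k - of_bool (k = Suc i)"
proof (induction k)
  case (Suc k)
  then show ?case
    using assms by (auto simp: prefix_sum_def nth_list_update)
qed simp

text \<open>This form lets transitions be checked for \<open>inf_comp\<close>, whose prefix sums are
  easier to handle than its entries.\<close>

lemma transition_iff_prefix_sum:
  assumes "length b = length a"
  shows "transition \<theta> a b \<longleftrightarrow>
    (\<exists>i. Suc i < length a \<and> a ! i \<ge> 1 \<and> a ! i - a ! Suc i \<ge> \<theta> \<and>
         (\<forall>k\<le>length a. prefix_sum b k = prefix_sum a k - of_bool (k = Suc i)))"
proof -
  have "b = a[i := a ! i - 1, Suc i := a ! Suc i + 1] \<longleftrightarrow>
      (\<forall>k\<le>length a. prefix_sum b k = prefix_sum a k - of_bool (k = Suc i))"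
    if "Suc i < length a" for i
    using assms prefix_sum_fire[OF that]
    by (auto intro: list_eqI_prefix_sum)
  then show ?thesis
    unfolding transition_def by blast
qed

lemma transition_length: "transition \<theta> a b \<Longrightarrow> length b = length a"
  by (auto simp: transition_def)

lemma transition_prefix_sum_le:
  "transition \<theta> a b \<Longrightarrow> prefix_sum b k \<le> prefix_sum a k"
  by (auto simp: transition_def prefix_sum_fire)

lemma sum_list_eq_prefix_sum: "sum_list a = prefix_sum a (length a)"
  by (simp add: prefix_sum_def sum_list_sum_nth atLeast0LessThan)

lemma transition_composition:
  assumes "transition \<theta> a b" and "composition n a"
  shows "composition n b"
proof -
  obtain i where i: "Suc i < length a" "a ! i \<ge> 1"
      "b = a[i := a ! i - 1, Suc i := a ! Suc i + 1]"
    using assms(1) by (auto simp: transition_def)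
  have a: "0 \<le> a ! j" if "j < length a" for j
    using that assms(2) by (simp add: composition_def)
  have "0 \<le> x" if "x \<in> set b" for x
    using that i a a[of "Suc i"] by (auto simp: in_set_conv_nth nth_list_update split: if_splits)
  moreover have "sum_list b = sum_list a"
    using i by (simp add: sum_list_eq_prefix_sum prefix_sum_fire)
  ultimately show ?thesis
    using assms transition_length[OF assms(1)] by (simp add: composition_def)
qed

lemma reaches_length: "reaches \<theta> a b \<Longrightarrow> length b = length a"
  unfolding reaches_def by (induction rule: rtranclp_induct) (auto dest: transition_length)

lemma reaches_prefix_sum_le: "reaches \<theta> a b \<Longrightarrow> prefix_sum b k \<le> prefix_sum a k"
  unfolding reaches_def
  by (induction rule: rtranclp_induct) (auto intro: order_trans transition_prefix_sum_le)

lemma reaches_composition: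
  "reaches \<theta> a b \<Longrightarrow> composition n a \<Longrightarrow> composition n b"
  unfolding reaches_def
  by (induction rule: rtranclp_induct) (auto intro: transition_composition)

lemma reaches_refl [simp]: "reaches \<theta> a a"
  by (simp add: reaches_def)

lemma reaches_trans: "reaches \<theta> a b \<Longrightarrow> reaches \<theta> b c \<Longrightarrow> reaches \<theta> a c"
  by (auto simp: reaches_def)

text \<open>Prefix sums never increase along a path, so mutual reachability forces them to
  agree.\<close>

lemma reaches_antisym: "reaches \<theta> a b \<Longrightarrow> reaches \<theta> b a \<Longrightarrow> a = b"
  by (rule list_eqI_prefix_sum) (auto intro: order_antisym reaches_prefix_sum_le dest: reaches_length)

lemma length_inf_comp [simp]: "length (inf_comp n a b) = n"
  by (simp add: inf_comp_def)

lemma sum_inf_entry: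
  "(\<Sum>j<k. inf_entry a b j) = min (prefix_sum a k) (prefix_sum b k)"
proof (cases k)
  case (Suc i)
  then show ?thesis
    by (simp add: inf_entry.simps[of a b i] prefix_sum_def lessThan_Suc_atMost[symmetric])
qed simp

lemma prefix_sum_inf_comp:
  assumes "k \<le> n"
  shows "prefix_sum (inf_comp n a b) k = min (prefix_sum a k) (prefix_sum b k)"
proof -
  have "prefix_sum (inf_comp n a b) k = (\<Sum>j<k. inf_entry a b j)"
    unfolding prefix_sum_def using assms by (intro sum.cong) (auto simp: inf_comp_def)
  then show ?thesis
    by (simp add: sum_inf_entry)
qed

lemma inf_comp_commute: "inf_comp n a b = inf_comp n b a"
  by (rule list_eqI_prefix_sum) (simp_all add: prefix_sum_inf_comp min.commute)

lemma inf_comp_absorb: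
  assumes "length b = n" and "\<And>k. k \<le> n \<Longrightarrow> prefix_sum b k \<le> prefix_sum a k"
  shows "inf_comp n a b = b"
  using assms by (intro list_eqI_prefix_sum) (simp_all add: prefix_sum_inf_comp)

text \<open>Lowering the prefix sums on either side of position \<open>i\<close> while keeping the one at \<open>i\<close>
  can only make position \<open>i\<close> steeper, so it stays fireable.\<close>

lemma transition_inf_comp:
  assumes "transition \<theta> x y" and "length x = n"
  shows "inf_comp n m y = inf_comp n m x \<or> transition \<theta> (inf_comp n m x) (inf_comp n m y)"
proof -
  let ?u = "inf_comp n m x" and ?v = "inf_comp n m y"
  obtain i where i: "Suc i < n" "x ! i \<ge> 1" "x ! i - x ! Suc i \<ge> \<theta>"
    and y: "\<And>k. k \<le> n \<Longrightarrow> prefix_sum y k = prefix_sum x k - of_bool (k = Suc i)"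
    using assms transition_iff_prefix_sum[OF transition_length[OF assms(1)], of \<theta>] by auto
  show ?thesis
  \<comment> \<open>If \<open>x\<close> attains the minimum at \<open>Suc i\<close>, its drop by one
    passes to \<open>?v\<close>. Otherwise, by integrality, \<open>m\<close> is already at or below
    the lowered value and masks the drop.\<close>
  proof (cases "prefix_sum x (Suc i) \<le> prefix_sum m (Suc i)")
    case True
    have "x ! i \<le> ?u ! i" and "?u ! Suc i \<le> x ! Suc i"
      using i(1) True by (auto simp: nth_eq_diff_prefix_sum prefix_sum_inf_comp)
    moreover have "prefix_sum ?v k = prefix_sum ?u k - of_bool (k = Suc i)" if "k \<le> n" for k
      using that True by (auto simp: y prefix_sum_inf_comp)
    ultimately have "transition \<theta> ?u ?v"
      using i by (subst transition_iff_prefix_sum) (auto intro!: exI[of _ i])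
    then show ?thesis ..
  next
    case False
    then have "?v = ?u"
      by (intro list_eqI_prefix_sum) (auto simp: y prefix_sum_inf_comp)
    then show ?thesis ..
  qed
qed

lemma reaches_inf_comp:
  assumes "reaches \<theta> x y" and "length x = n"
  shows "reaches \<theta> (inf_comp n m x) (inf_comp n m y)"
  using assms unfolding reaches_def
proof (induction rule: rtranclp_induct)
  case (step y z)
  then have "length y = n"
    by (metis reaches_def reaches_length)
  with step show ?case
    by (metis transition_inf_comp rtranclp.rtrancl_into_rtrancl)
qed simp

lemma L_length: "a \<in> L n \<theta> \<Longrightarrow> length a = n"
  by (simp add: L_def composition_def)

lemma L_reaches_inf_comp:
  assumes "a \<in> L n \<theta>" and "b \<in> L n \<theta>"
  shows "reaches \<theta> a (inf_comp n a b)"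
proof -
  have a: "reaches \<theta> (initial n) a" and b: "reaches \<theta> (initial n) b"
    using assms by (auto simp: L_def)
  \<comment> \<open>Since \<open>initial n\<close> dominates \<open>a\<close> in prefix sums, the
    image of the path from \<open>initial n\<close> to \<open>b\<close> starts at \<open>a\<close>
    itself.\<close>
  have "inf_comp n a (initial n) = a"
    by (subst inf_comp_commute)
      (use a L_length[OF assms(1)] in \<open>auto intro: inf_comp_absorb reaches_prefix_sum_le\<close>)
  then show ?thesis
    using reaches_inf_comp[OF b, of n a] reaches_length[OF a] L_length[OF assms(1)] by simp
qed

lemma inf_comp_in_L:
  assumes "a \<in> L n \<theta>" and "b \<in> L n \<theta>"
  shows "inf_comp n a b \<in> L n \<theta>"
  using assms L_reaches_inf_comp[OF assms]
  by (auto simp: L_def intro: reaches_composition reaches_trans)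

text \<open>If \<open>b\<close> lies below \<open>a\<close> in prefix sums, then
  \<open>inf_comp n a b\<close> is \<open>b\<close>, so the path from \<open>a\<close> to the
  infimum ends at \<open>b\<close>.\<close>

lemma L_reaches_iff_prefix_sum_le:
  assumes "a \<in> L n \<theta>" and "b \<in> L n \<theta>"
  shows "reaches \<theta> a b \<longleftrightarrow> (\<forall>k\<le>n. prefix_sum b k \<le> prefix_sum a k)"
  using L_reaches_inf_comp[OF assms] inf_comp_absorb[of b n a] L_length[OF assms(2)]
  by (auto dest: reaches_prefix_sum_le)

lemma is_glb_inf_comp:
  assumes "a \<in> L n \<theta>" and "b \<in> L n \<theta>"
  shows "is_glb (L_order n \<theta>) (inf_comp n a b) {a, b}"
proof -
  let ?c = "inf_comp n a b"
  have "reaches \<theta> b ?c"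
    using L_reaches_inf_comp[OF assms(2,1)] by (simp add: inf_comp_commute)
  \<comment> \<open>A common lower bound lies below the pointwise minimum in prefix sums; as
    \<open>?c\<close> and \<open>d\<close> are both in \<open>L n \<theta>\<close>, this already
    yields a path.\<close>
  moreover have "reaches \<theta> ?c d" if "d \<in> L n \<theta>" "reaches \<theta> a d" "reaches \<theta> b d" for d
    using that(2,3)
    by (auto simp: L_reaches_iff_prefix_sum_le[OF inf_comp_in_L[OF assms] that(1)]
        prefix_sum_inf_comp reaches_prefix_sum_le)
  ultimately show ?thesis
    using assms L_reaches_inf_comp[OF assms] inf_comp_in_L[OF assms]
    by (auto simp: greatest_def Lower_def L_order_def)
qed

text \<open>Entries are nonnegative with total \<open>n\<close>, so each is at most
  \<open>n\<close>. Finiteness is needed to obtain joins from meets.\<close>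

lemma finite_L: "finite (L n \<theta>)"
proof (rule finite_subset)
  show "L n \<theta> \<subseteq> {a. set a \<subseteq> {0..int n} \<and> length a = n}"
  proof (intro subsetI CollectI conjI)
    fix a x
    assume a: "a \<in> L n \<theta>" and x: "x \<in> set a"
    obtain us vs where "a = us @ x # vs"
      using x by (auto simp: in_set_conv_decomp)
    moreover from this have "sum_list us \<ge> 0" "sum_list vs \<ge> 0" "x \<ge> 0"
      using a by (auto simp: L_def composition_def intro: sum_list_nonneg)
    ultimately show "x \<in> {0..int n}"
      using a by (auto simp: L_def composition_def)
  qed (rule L_length)
  show "finite {a. set a \<subseteq> {0..int n} \<and> length a = n}"
    by (rule finite_lists_length_eq) simp
qed

text \<open>The case \<open>n = 0\<close> is excluded because \<open>initial 0\<close> has one entry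
  and hence is not a composition of 0 in the sense of \<open>composition\<close>.\<close>

lemma initial_in_L:
  assumes "n \<ge> 1"
  shows "initial n \<in> L n \<theta>"
  using assms by (auto simp: L_def composition_def initial_def sum_list_replicate)

interpretation L_order: partial_order "L_order n \<theta>"
  by unfold_locales (auto simp: L_order_def intro: reaches_antisym reaches_trans)

interpretation L_order: lower_semilattice "L_order n \<theta>"
proof unfold_locales
  show "\<exists>s. is_glb (L_order n \<theta>) s {x, y}"
    if "x \<in> carrier (L_order n \<theta>)" "y \<in> carrier (L_order n \<theta>)" for x y
    using that is_glb_inf_comp[of x n \<theta> y] by (auto simp: L_order_def)
qed

theorem theorem7:
  fixes n :: nat and \<theta> :: int
  assumes "n \<ge> 1"
  shows "lattice (L_order n \<theta>) \<and>
    (\<forall>a\<in>L n \<theta>. \<forall>b\<in>L n \<theta>.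
       is_glb (L_order n \<theta>) (inf_comp n a b) {a, b})"
proof -
  have "lattice (L_order n \<theta>)"
  proof unfold_locales
    \<comment> \<open>By construction of \<open>L\<close>, everything is reached from
      \<open>initial n\<close>, which therefore serves as the top element for the existence of
      joins.\<close>
    have "x \<sqsubseteq>\<^bsub>L_order n \<theta>\<^esub> initial n" if "x \<in> carrier (L_order n \<theta>)" for x
      using that by (auto simp: L_order_def L_def)
    then show "\<exists>s. is_lub (L_order n \<theta>) s {x, y}"
      if "x \<in> carrier (L_order n \<theta>)" "y \<in> carrier (L_order n \<theta>)" for x y
      using that initial_in_L[OF assms] finite_L
      by (intro L_order.is_lub_exists_if_finite[of n \<theta> "initial n"]) (auto simp: L_order_def)
  qed
  then show ?thesis
    using is_glb_inf_comp by blast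
qed

end
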